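(* There is a function $g\in\bigcap_{k\ge2}\mathcal H_{\Phi_{(k)}}$ that does not multiply on $\mathcal H_{\Phi_{1/2}}$, i.e. $g\notin\operatorname{Mult}(\mathcal H_{\Phi_{1/2}})$.
   Context: $\mathbb D$ is the open unit disk, $\mathbb T=\partial\mathbb D$ with normalized Lebesgue measure $m$, $\operatorname{Hol}(\mathbb D)$ is the space of holomorphic functions on $\mathbb D$, and $N^+$ is the Smirnov class on $\mathbb D$; functions in $N^+$ have non-tangential boundary values a.e. on $\mathbb T$, denoted by the same letter. A function $\varphi:\mathbb R\to[0,\infty)$ is strongly convex if it is convex, nondecreasing and $\lim_{t\to\infty}\varphi(t)/t=\infty$; one sets $\varphi(-\infty)=0$. With $\Phi=\varphi\circ\log$, the Hardy-Orlicz class is $\mathcal H_\Phi=\{f\in N^+:\int_{\mathbb T}\Phi(|f|)\,dm<\infty\}$. For $X\subset\operatorname{Hol}(\mathbb D)$, $\operatorname{Mult}(X)=\{g\in\operatorname{Hol}(\mathbb D): gf\in X \text{ for all } f\in X\}$. $\Phi_{1/2}=\varphi_{1/2}\circ\log$, where $\varphi_{1/2}(t)=e^{\sqrt t}$ for all sufficiently large $t$, extended to a strongly convex function on $\mathbb R$. For $k\ge1$, $\log_k=\log\circ\cdots\circ\log$ ($k$ times); $e_1=e$, $e_{k+1}=e^{e_k}$. For $k\ge2$, $\varphi_{(k)}(t)=\exp\big(t/\log_{k-1}(t)\big)$ for $t\ge e_{2k}$, completed suitably for $t<e_{2k}$ to a strongly convex function, and $\Phi_{(k)}=\varphi_{(k)}\circ\log$.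 (The Hardy-Orlicz class depends only on the values of the defining function for large $t$.) *)

theory Defs
  imports "HOL-Complex_Analysis.Complex_Analysis" "HOL-Probability.Probability"
begin

abbreviation unit_disk :: "complex set" where
  "unit_disk \<equiv> ball 0 1"

text \<open>A function on the disk is a total function of type \<^typ>\<open>complex \<Rightarrow> complex\<close>;
  none of the notions below depends on its values outside the disk.\<close>

text \<open>Normalized Lebesgue measure on the unit circle, as a Borel probability measure on the
  complex plane concentrated on the circle.\<close>

definition circle_measure :: "complex measure" where
  "circle_measure = distr (uniform_measure lborel {0..2 * pi}) borel cis"

definition herglotz :: "(complex \<Rightarrow> real) \<Rightarrow> complex \<Rightarrow> complex" where
  "herglotz w z = (LINT \<zeta>|circle_measure. (\<zeta> + z) / (\<zeta> - z) * complex_of_real (w \<zeta>))"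

text \<open>Here \<open>w\<close> plays the role of \<open>log \<psi>\<close>, where \<open>\<psi>\<close> is the boundary modulus of \<open>v\<close>.\<close>

definition outer_function :: "(complex \<Rightarrow> complex) \<Rightarrow> bool" where
  "outer_function v \<longleftrightarrow>
     (\<exists>c w. norm c = 1 \<and> integrable circle_measure w \<and>
            (\<forall>z\<in>unit_disk. v z = c * exp (herglotz w z)))"

text \<open>The Smirnov class: quotients of bounded holomorphic functions with outer denominator.\<close>

definition smirnov_class :: "(complex \<Rightarrow> complex) set" where
  "smirnov_class = {f. \<exists>u v.
     u holomorphic_on unit_disk \<and> bounded (u ` unit_disk) \<and>
     v holomorphic_on unit_disk \<and> bounded (v ` unit_disk) \<and> outer_function v \<and>
     (\<forall>z\<in>unit_disk. f z = u z / v z)}"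

definition stolz_region :: "real \<Rightarrow> complex \<Rightarrow> complex set" where
  "stolz_region \<alpha> \<zeta> = {z \<in> unit_disk. dist z \<zeta> < \<alpha> * (1 - norm z)}"

definition nontangential_limit :: "(complex \<Rightarrow> complex) \<Rightarrow> complex \<Rightarrow> complex \<Rightarrow> bool" where
  "nontangential_limit f \<zeta> a \<longleftrightarrow> (\<forall>\<alpha>>1. (f \<longlongrightarrow> a) (at \<zeta> within stolz_region \<alpha> \<zeta>))"

text \<open>The value is unspecified where the limit does not exist; for a function in the Smirnov
  class this is a null set, so it does not affect the integral over the circle.\<close>

definition boundary_value :: "(complex \<Rightarrow> complex) \<Rightarrow> complex \<Rightarrow> complex" where
  "boundary_value f \<zeta> = (THE a. nontangential_limit f \<zeta> a)"

definition strongly_convex :: "(real \<Rightarrow> real) \<Rightarrow> bool" where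
  "strongly_convex \<phi> \<longleftrightarrow>
     (\<forall>t. 0 \<le> \<phi> t) \<and> convex_on UNIV \<phi> \<and> mono \<phi> \<and>
     filterlim (\<lambda>t. \<phi> t / t) at_top at_top"

text \<open>\<open>\<phi> \<circ> log\<close> on \<open>[0, \<infinity>)\<close>, with the convention \<open>\<phi> (-\<infinity>) = 0\<close>.\<close>

definition comp_log :: "(real \<Rightarrow> real) \<Rightarrow> real \<Rightarrow> real" where
  "comp_log \<phi> x = (if x = 0 then 0 else \<phi> (ln x))"

definition hardy_orlicz :: "(real \<Rightarrow> real) \<Rightarrow> (complex \<Rightarrow> complex) set" where
  "hardy_orlicz \<Phi> = {f \<in> smirnov_class.
     (\<integral>\<^sup>+ \<zeta>. ennreal (\<Phi> (norm (boundary_value f \<zeta>))) \<partial>circle_measure) < \<infinity>}"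

definition Mult :: "(complex \<Rightarrow> complex) set \<Rightarrow> (complex \<Rightarrow> complex) set" where
  "Mult X = {g. g holomorphic_on unit_disk \<and> (\<forall>f\<in>X. (\<lambda>z. g z * f z) \<in> X)}"

definition iter_log :: "nat \<Rightarrow> real \<Rightarrow> real" where
  "iter_log k = ln ^^ k"

definition exp_tower :: "nat \<Rightarrow> real" where
  "exp_tower k = (exp ^^ k) 1"

text \<open>The two growth functions are prescribed only for large arguments. The predicates below
  hold of every strongly convex completion, since the choice of completion is immaterial for the
  Hardy-Orlicz class.\<close>

definition is_phi_half :: "(real \<Rightarrow> real) \<Rightarrow> bool" where
  "is_phi_half \<phi> \<longleftrightarrow>
     strongly_convex \<phi> \<and> (\<forall>\<^sub>F t in at_top. \<phi> t = exp (sqrt t))"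

definition is_phi_level :: "nat \<Rightarrow> (real \<Rightarrow> real) \<Rightarrow> bool" where
  "is_phi_level k \<phi> \<longleftrightarrow>
     strongly_convex \<phi> \<and> (\<forall>t\<ge>exp_tower (2 * k). \<phi> t = exp (t / iter_log (k - 1) t))"

end

(* Build g and f as outer functions whose boundary moduli exp w are such that w is a step function on
   disjoint arcs accumulating at 1. On the n-th arc, of length 2^-(n+1) exp (-M n), take
   log |f| = (M n)^2 and log |g| = L n * M n with L n = 3 (n + 1). Then f lies in the class of phi_half,
   but sqrt ((M n)^2 + L n * M n) >= M n + (n + 1), so the integral for f g diverges. If M n is so
   large that the first n iterated logarithms of L n * M n exceed L n, then
   phi k (L n * M n) <= exp (M n) for n >= k, so g lies in every class of the hierarchy.
   Since w is locally constant off a countable set, the existence of the boundary values is elementary: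
   subtracting the local constant makes the Herglotz integral continuous up to the arc. *)
theory Submission
  imports Defs "HOL-Real_Asymp.Real_Asymp"
begin

section \<open>Normalized Lebesgue measure on the circle\<close>

lemma space_circle_measure [simp]: "space circle_measure = UNIV"
  and sets_circle_measure [simp, measurable_cong]: "sets circle_measure = sets borel"
  by (simp_all add: circle_measure_def)

lemma measurable_cis_uniform [measurable]: "cis \<in> borel_measurable (uniform_measure lborel A)"
proof -
  have "cis \<in> borel_measurable borel"
    by (intro borel_measurable_continuous_onI continuous_intros)
  then show ?thesis by simp
qed

lemma prob_space_circle_measure: "prob_space circle_measure"
  unfolding circle_measure_def
  by (intro prob_space.prob_space_distr prob_space_uniform_measure) auto

lemma AE_circle_measureI:
  assumes "{\<zeta>. P \<zeta>} \<in> sets borel" "AE t in lborel. P (cis t)"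
  shows "AE \<zeta> in circle_measure. P \<zeta>"
proof -
  have "AE t in uniform_measure lborel {0..2 * pi}. P (cis t)"
    using assms(2) by (intro AE_uniform_measureI) auto
  then show ?thesis
    unfolding circle_measure_def using assms(1) by (subst AE_distr_iff) auto
qed

lemma AE_circle_measure_norm: "AE \<zeta> in circle_measure. norm \<zeta> = 1"
  by (rule AE_circle_measureI) auto

text \<open>A fibre of \<open>cis\<close> lies in a translate of the multiples of 2 pi, so it is
  countable and null, and countably many fibres remain null. This discards the endpoints of the arcs
  later.\<close>

lemma AE_circle_measure_not_in_countable:
  assumes "countable N"
  shows "AE \<zeta> in circle_measure. \<zeta> \<notin> N"
proof (rule AE_circle_measureI)
  show "{\<zeta>. \<zeta> \<notin> N} \<in> sets borel"
    using borel_comp[OF sets.countable[OF _ assms, of borel]] by (simp add: Compl_eq)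
  have "AE t in lborel. cis t \<noteq> \<zeta>" for \<zeta>
  proof (cases "\<exists>s. cis s = \<zeta>")
    case True
    then obtain s where s: "\<zeta> = cis s" by auto
    have "{t. cis t = \<zeta>} \<subseteq> range (\<lambda>n::int. s + 2 * pi * n)"
      using sin_cos_eq_iff[of _ s] s by (auto simp: complex_eq_iff)
    then have "countable {t. cis t = \<zeta>}"
      by (rule countable_subset) auto
    then have "{t. cis t = \<zeta>} \<in> null_sets lborel"
      by (rule countable_imp_null_set_lborel)
    then show ?thesis
      by (auto dest: AE_not_in)
  qed auto
  then have "AE t in lborel. \<forall>\<zeta>\<in>N. cis t \<noteq> \<zeta>"
    by (simp add: AE_ball_countable assms)
  then show "AE t in lborel. cis t \<notin> N" by eventually_elim auto
qed

lemma nn_integral_circle_measure: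
  assumes [measurable]: "f \<in> borel_measurable borel"
  shows "(\<integral>\<^sup>+ \<zeta>. f \<zeta> \<partial>circle_measure) =
    (\<integral>\<^sup>+ t\<in>{0..2 * pi}. f (cis t) \<partial>lborel) / ennreal (2 * pi)"
proof -
  have [measurable]: "cis \<in> borel_measurable borel"
    by (intro borel_measurable_continuous_onI continuous_intros)
  show ?thesis
    unfolding circle_measure_def
    by (subst nn_integral_distr) (simp_all add: nn_integral_uniform_measure)
qed

text \<open>Dominated convergence speaks of sequences, so the limit is tested along sequences in
  \<open>S\<close> that avoid the limit point. It serves twice: for difference quotients of the
  Herglotz integral inside the disk, and for its limit at a boundary point.\<close>

lemma tendsto_LINT_kernel:
  fixes k :: "complex \<Rightarrow> 'a \<Rightarrow> complex"
  assumes w: "integrable M w"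
    and [measurable]: "\<And>z. k z \<in> borel_measurable M" "k\<^sub>0 \<in> borel_measurable M"
    and lim: "AE \<zeta> in M. ((\<lambda>z. k z \<zeta> * complex_of_real (w \<zeta>)) \<longlongrightarrow> k\<^sub>0 \<zeta> * complex_of_real (w \<zeta>)) (at z\<^sub>0 within S)"
    and bound: "\<And>z. z \<in> S \<Longrightarrow> z \<noteq> z\<^sub>0 \<Longrightarrow> AE \<zeta> in M. norm (k z \<zeta> * complex_of_real (w \<zeta>)) \<le> B * \<bar>w \<zeta>\<bar>"
  shows "((\<lambda>z. LINT \<zeta>|M. k z \<zeta> * complex_of_real (w \<zeta>)) \<longlongrightarrow> (LINT \<zeta>|M. k\<^sub>0 \<zeta> * complex_of_real (w \<zeta>))) (at z\<^sub>0 within S)"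
  unfolding tendsto_at_iff_sequentially
proof (intro allI impI)
  fix X :: "nat \<Rightarrow> complex"
  assume X: "\<forall>i. X i \<in> S - {z\<^sub>0}" "X \<longlonglongrightarrow> z\<^sub>0"
  have [measurable]: "w \<in> borel_measurable M" using w by auto
  show "((\<lambda>z. LINT \<zeta>|M. k z \<zeta> * complex_of_real (w \<zeta>)) \<circ> X) \<longlonglongrightarrow> (LINT \<zeta>|M. k\<^sub>0 \<zeta> * complex_of_real (w \<zeta>))"
    unfolding o_def
  proof (rule integral_dominated_convergence)
    show "integrable M (\<lambda>\<zeta>. B * \<bar>w \<zeta>\<bar>)" using w by auto
    show "AE \<zeta> in M. (\<lambda>i. k (X i) \<zeta> * complex_of_real (w \<zeta>)) \<longlonglongrightarrow> k\<^sub>0 \<zeta> * complex_of_real (w \<zeta>)"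
      using lim
    proof eventually_elim
      case (elim \<zeta>)
      with X show ?case unfolding tendsto_at_iff_sequentially o_def by blast
    qed
  qed (use X bound in auto)
qed

section \<open>The Herglotz integral inside the disk\<close>

lemma norm_diff_ge_on_circle:
  fixes \<zeta> z :: complex
  assumes "norm \<zeta> = 1"
  shows "1 - norm z \<le> norm (\<zeta> - z)"
  using norm_triangle_ineq2[of \<zeta> z] assms by simp

lemma integrable_herglotz_kernel:
  assumes w: "integrable circle_measure w" and z: "z \<in> unit_disk"
  shows "integrable circle_measure (\<lambda>\<zeta>. (\<zeta> + z) / (\<zeta> - z) * complex_of_real (w \<zeta>))"
proof (rule Bochner_Integration.integrable_bound)
  show "integrable circle_measure (\<lambda>\<zeta>. 2 / (1 - norm z) * w \<zeta>)" using w by simp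
  have [measurable]: "w \<in> borel_measurable borel" using borel_measurable_integrable[OF w] by simp
  show "(\<lambda>\<zeta>. (\<zeta> + z) / (\<zeta> - z) * complex_of_real (w \<zeta>)) \<in> borel_measurable circle_measure"
    by measurable
  show "AE \<zeta> in circle_measure. norm ((\<zeta> + z) / (\<zeta> - z) * complex_of_real (w \<zeta>))
      \<le> norm (2 / (1 - norm z) * w \<zeta>)"
    using AE_circle_measure_norm
  proof eventually_elim
    case (elim \<zeta>)
    have "norm (\<zeta> + z) \<le> 2" using norm_triangle_ineq[of \<zeta> z] elim z by simp
    then have "norm (\<zeta> + z) / norm (\<zeta> - z) \<le> 2 / (1 - norm z)"
      using norm_diff_ge_on_circle[OF elim, of z] z by (intro frac_le) auto
    then have "norm (\<zeta> + z) / norm (\<zeta> - z) * \<bar>w \<zeta>\<bar> \<le> 2 / (1 - norm z) * \<bar>w \<zeta>\<bar>"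
      by (rule mult_right_mono) simp
    then show ?case
      using z by (simp add: norm_mult norm_divide abs_mult)
  qed
qed

text \<open>For \<zeta> on the circle and z inside, this is the Poisson kernel, which is positive.
  For two points of the circle it is 0, which later determines the modulus of the boundary
  values.\<close>

lemma Re_herglotz_kernel:
  fixes \<zeta> z :: complex
  shows "Re ((\<zeta> + z) / (\<zeta> - z)) = ((norm \<zeta>)\<^sup>2 - (norm z)\<^sup>2) / (norm (\<zeta> - z))\<^sup>2"
  unfolding Re_divide cmod_power2 by (simp add: power2_eq_square algebra_simps)

text \<open>The real part is the Poisson integral of a nonnegative function. This will bound
  \<open>exp (- herglotz w z)\<close> by 1.\<close>

lemma Re_herglotz_nonneg:
  assumes w: "integrable circle_measure w" "\<And>\<zeta>. 0 \<le> w \<zeta>" and z: "z \<in> unit_disk"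
  shows "0 \<le> Re (herglotz w z)"
proof -
  have "Re (herglotz w z) = (LINT \<zeta>|circle_measure. Re ((\<zeta> + z) / (\<zeta> - z) * complex_of_real (w \<zeta>)))"
    unfolding herglotz_def by (subst integral_Re[OF integrable_herglotz_kernel]) (use w z in auto)
  also have "\<dots> \<ge> 0"
  proof (rule integral_nonneg_AE)
    show "AE \<zeta> in circle_measure. 0 \<le> Re ((\<zeta> + z) / (\<zeta> - z) * complex_of_real (w \<zeta>))"
      using AE_circle_measure_norm
    proof eventually_elim
      case (elim \<zeta>)
      have "(norm z)\<^sup>2 \<le> 1" using z by (auto intro: power_le_one)
      then have "0 \<le> Re ((\<zeta> + z) / (\<zeta> - z))" using elim by (simp add: Re_herglotz_kernel)
      moreover have "Re (k * complex_of_real c) = Re k * c" for k c by simp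
      ultimately show ?case using w(2) by (simp only: mult_nonneg_nonneg)
    qed
  qed
  finally show ?thesis .
qed

text \<open>Differentiation under the integral sign: the difference quotients at a point converge by
  dominated convergence, since the kernel is singular only on the circle.\<close>

lemma holomorphic_herglotz:
  assumes w: "integrable circle_measure w"
  shows "herglotz w holomorphic_on unit_disk"
proof (rule holomorphic_onI)
  fix z\<^sub>0 :: complex assume z0: "z\<^sub>0 \<in> unit_disk"
  \<comment> \<open>Half the distance to the circle, so that every point of the ball of radius
    \<open>r\<close> still has distance at least \<open>r\<close> from the circle.\<close>
  define r where "r = (1 - norm z\<^sub>0) / 2"
  have r: "r > 0" using z0 by (simp add: r_def)
  have far: "r \<le> norm (\<zeta> - z)" if "norm \<zeta> = 1" "z \<in> ball z\<^sub>0 r" for \<zeta> z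
  proof -
    have "norm z \<le> norm z\<^sub>0 + r"
      using that norm_triangle_ineq2[of z z\<^sub>0] by (simp add: dist_norm norm_minus_commute)
    moreover have "norm z\<^sub>0 = 1 - 2 * r" by (simp add: r_def field_simps)
    ultimately show ?thesis using norm_diff_ge_on_circle[OF that(1), of z] by linarith
  qed
  have near: "z \<in> unit_disk" if "z \<in> ball z\<^sub>0 r" for z
    using that norm_triangle_ineq2[of z z\<^sub>0] z0 by (auto simp: dist_norm norm_minus_commute r_def)
  \<comment> \<open>This is the difference quotient of (\<zeta> + z) / (\<zeta> - z) in z after
    cancellation; at \<open>z = z\<^sub>0\<close> it is the derivative of the kernel.\<close>
  define k where "k z \<zeta> = 2 * \<zeta> / ((\<zeta> - z) * (\<zeta> - z\<^sub>0))" for z \<zeta> :: complex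
  have lim: "((\<lambda>z. LINT \<zeta>|circle_measure. k z \<zeta> * complex_of_real (w \<zeta>)) \<longlongrightarrow>
      (LINT \<zeta>|circle_measure. k z\<^sub>0 \<zeta> * complex_of_real (w \<zeta>))) (at z\<^sub>0 within ball z\<^sub>0 r)"
  proof (rule tendsto_LINT_kernel[OF w, where B = "2 / (r * r)"])
    show "k z \<in> borel_measurable circle_measure" "k z\<^sub>0 \<in> borel_measurable circle_measure" for z
      unfolding k_def by measurable
    show "AE \<zeta> in circle_measure. ((\<lambda>z. k z \<zeta> * complex_of_real (w \<zeta>)) \<longlongrightarrow>
        k z\<^sub>0 \<zeta> * complex_of_real (w \<zeta>)) (at z\<^sub>0 within ball z\<^sub>0 r)"
      using AE_circle_measure_norm
    proof eventually_elim
      case (elim \<zeta>)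
      then have "\<zeta> \<noteq> z\<^sub>0" using z0 by auto
      then show ?case unfolding k_def by (intro tendsto_intros) auto
    qed
    show "AE \<zeta> in circle_measure. norm (k z \<zeta> * complex_of_real (w \<zeta>)) \<le> 2 / (r * r) * \<bar>w \<zeta>\<bar>"
      if "z \<in> ball z\<^sub>0 r" for z
      using AE_circle_measure_norm
    proof eventually_elim
      case (elim \<zeta>)
      have "r * r \<le> norm (\<zeta> - z) * norm (\<zeta> - z\<^sub>0)"
        using far[OF elim that] far[OF elim, of z\<^sub>0] r by (intro mult_mono) auto
      then have "norm (k z \<zeta>) \<le> 2 / (r * r)"
        unfolding k_def using r elim by (simp add: norm_mult norm_divide frac_le)
      then show ?case by (simp only: norm_mult norm_of_real mult_right_mono abs_ge_zero)
    qed
  qed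
  have quotient: "(herglotz w z - herglotz w z\<^sub>0) / (z - z\<^sub>0) =
      (LINT \<zeta>|circle_measure. k z \<zeta> * complex_of_real (w \<zeta>))"
    if z: "z \<in> ball z\<^sub>0 r" "z \<noteq> z\<^sub>0" for z
  proof -
    have "(herglotz w z - herglotz w z\<^sub>0) / (z - z\<^sub>0) = (LINT \<zeta>|circle_measure.
        ((\<zeta> + z) / (\<zeta> - z) * complex_of_real (w \<zeta>) -
         (\<zeta> + z\<^sub>0) / (\<zeta> - z\<^sub>0) * complex_of_real (w \<zeta>)) / (z - z\<^sub>0))"
      unfolding herglotz_def integral_divide_zero
        Bochner_Integration.integral_diff[OF integrable_herglotz_kernel[OF w near[OF z(1)]]
          integrable_herglotz_kernel[OF w z0]] ..
    also have "\<dots> = (LINT \<zeta>|circle_measure. k z \<zeta> * complex_of_real (w \<zeta>))"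
    proof (rule integral_cong_AE)
      have [measurable]: "w \<in> borel_measurable borel" using borel_measurable_integrable[OF w] by simp
      show "(\<lambda>\<zeta>. ((\<zeta> + z) / (\<zeta> - z) * complex_of_real (w \<zeta>) -
         (\<zeta> + z\<^sub>0) / (\<zeta> - z\<^sub>0) * complex_of_real (w \<zeta>)) / (z - z\<^sub>0)) \<in> borel_measurable circle_measure"
        "(\<lambda>\<zeta>. k z \<zeta> * complex_of_real (w \<zeta>)) \<in> borel_measurable circle_measure"
        unfolding k_def by measurable
      show "AE \<zeta> in circle_measure. ((\<zeta> + z) / (\<zeta> - z) * complex_of_real (w \<zeta>) -
         (\<zeta> + z\<^sub>0) / (\<zeta> - z\<^sub>0) * complex_of_real (w \<zeta>)) / (z - z\<^sub>0) = k z \<zeta> * complex_of_real (w \<zeta>)"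
        using AE_circle_measure_norm
      proof eventually_elim
        case (elim \<zeta>)
        have ne: "\<zeta> - z \<noteq> 0" "\<zeta> - z\<^sub>0 \<noteq> 0" "z - z\<^sub>0 \<noteq> 0"
          using elim z near[OF z(1)] z0 by auto
        have "(\<zeta> + z) / (\<zeta> - z) - (\<zeta> + z\<^sub>0) / (\<zeta> - z\<^sub>0) = (z - z\<^sub>0) * k z \<zeta>"
          unfolding k_def using ne by (simp add: divide_simps) (simp add: algebra_simps)
        then show ?case
          unfolding left_diff_distrib[symmetric] using ne(3) by (simp only: mult.assoc) simp
      qed
    qed
    finally show ?thesis .
  qed
  have "((\<lambda>z. (herglotz w z - herglotz w z\<^sub>0) / (z - z\<^sub>0)) \<longlongrightarrow>
      (LINT \<zeta>|circle_measure. k z\<^sub>0 \<zeta> * complex_of_real (w \<zeta>))) (at z\<^sub>0 within ball z\<^sub>0 r)"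
    using lim by (rule Lim_transform_eventually)
      (auto simp: eventually_at_filter quotient)
  then have "(herglotz w has_field_derivative (LINT \<zeta>|circle_measure. k z\<^sub>0 \<zeta> * complex_of_real (w \<zeta>))) (at z\<^sub>0)"
    using r at_within_open[of z\<^sub>0 "ball z\<^sub>0 r"] by (simp add: has_field_derivative_iff)
  then show "herglotz w field_differentiable at z\<^sub>0 within unit_disk"
    by (metis field_differentiable_at_within field_differentiable_def)
qed

section \<open>Boundary values of exponentials of Herglotz integrals\<close>

lemma integral_circle_measure:
  fixes f :: "complex \<Rightarrow> complex"
  assumes f [measurable]: "f \<in> borel_measurable borel"
  shows "(LINT \<zeta>|circle_measure. f \<zeta>) = (LINT t:{0..2 * pi}|lborel. f (cis t)) / of_real (2 * pi)"
proof -
  have [measurable]: "cis \<in> borel_measurable borel"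
    by (intro borel_measurable_continuous_onI continuous_intros)
  \<comment> \<open>The density is rewritten as a real function, the form to which
    \<open>integral_density\<close> applies.\<close>
  have "uniform_measure lborel {0..2 * pi} =
      density lborel (\<lambda>t. ennreal (indicator {0..2 * pi} t / (2 * pi)))"
    unfolding uniform_measure_def
    by (intro arg_cong[of _ _ "density lborel"] ext) (auto simp: indicator_def divide_ennreal[symmetric])
  then have "(LINT \<zeta>|circle_measure. f \<zeta>) =
      (LINT t|lborel. (indicator {0..2 * pi} t / (2 * pi)) *\<^sub>R f (cis t))"
    unfolding circle_measure_def
    by (subst integral_distr) (simp_all add: integral_density)
  also have "\<dots> = (LINT t|lborel. (indicator {0..2 * pi} t *\<^sub>R f (cis t)) / of_real (2 * pi))"
    by (intro Bochner_Integration.integral_cong) (auto simp: indicator_def scaleR_conv_of_real)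
  also have "\<dots> = (LINT t:{0..2 * pi}|lborel. f (cis t)) / of_real (2 * pi)"
    unfolding set_lebesgue_integral_def by (rule integral_divide_zero)
  finally show ?thesis .
qed

text \<open>The kernel equals 2 \<zeta> / (\<zeta> - z) - 1. By Cauchy's formula for the constant 1
  the first term has mean 2, so the kernel has mean 1.\<close>

lemma herglotz_const:
  assumes z: "z \<in> unit_disk"
  shows "herglotz (\<lambda>_. c) z = of_real c"
proof -
  have ne: "cis t - z \<noteq> 0" for t using z by auto
  have cont: "continuous_on {0..2*pi} (\<lambda>t. (cis t + z) / (cis t - z) * of_real c)"
    using ne by (intro continuous_intros) auto
  have "((\<lambda>u. 1 / (u - z)) has_contour_integral 2 * of_real pi * \<i> * 1) (circlepath 0 1)"
    using Cauchy_integral_circlepath_simple[of "\<lambda>_. 1" 0 1 z] z by auto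
  then have "((\<lambda>t. \<i> * cis t / (cis t - z)) has_integral 2 * of_real pi * \<i>) {0..2*pi}"
    unfolding circlepath_def
    by (subst (asm) has_contour_integral_part_circlepath_iff) auto
  moreover have "((\<lambda>t. complex_of_real c) has_integral (2 * pi) *\<^sub>R of_real c) {0..2*pi}"
    using has_integral_const_real[of "complex_of_real c" 0 "2*pi"] by simp
  \<comment> \<open>Parametrizing the contour integral leaves a factor \<i>; multiplying by -2 \<i>
    turns it into the 2 of the decomposed kernel.\<close>
  ultimately have "((\<lambda>t. (-2 * \<i> * of_real c) * (\<i> * cis t / (cis t - z)) - of_real c) has_integral
      (-2 * \<i> * of_real c) * (2 * of_real pi * \<i>) - (2 * pi) *\<^sub>R of_real c) {0..2*pi}"
    by (intro has_integral_diff has_integral_mult_right)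
  also have "(\<lambda>t. (-2 * \<i> * of_real c) * (\<i> * cis t / (cis t - z)) - of_real c) =
      (\<lambda>t. (cis t + z) / (cis t - z) * of_real c)"
  proof
    fix t
    have "(-2 * \<i>) * (\<i> * cis t / (cis t - z)) - 1 = (cis t + z) / (cis t - z)"
      using ne[of t] by (simp add: field_simps)
    then have "((-2 * \<i>) * (\<i> * cis t / (cis t - z)) - 1) * of_real c =
        (cis t + z) / (cis t - z) * of_real c"
      by (simp only:)
    then show "(-2 * \<i> * of_real c) * (\<i> * cis t / (cis t - z)) - of_real c =
        (cis t + z) / (cis t - z) * of_real c"
      by (simp only: ring_distribs mult_1_left mult_1_right mult_ac)
  qed
  also have "(-2 * \<i> * of_real c) * (2 * of_real pi * \<i>) - (2 * pi) *\<^sub>R of_real c = of_real c * of_real (2 * pi)"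
    by (simp add: scaleR_conv_of_real algebra_simps)
  finally have "(LINT t:{0..2 * pi}|lborel. (cis t + z) / (cis t - z) * of_real c) = of_real c * of_real (2 * pi)"
    using set_borel_integral_eq_integral(2)[OF borel_integrable_atLeastAtMost'[OF cont]]
    by (simp add: integral_unique)
  then show ?thesis
    unfolding herglotz_def by (simp add: integral_circle_measure)
qed

text \<open>After subtraction of \<open>w \<zeta>\<^sub>0\<close> the weight vanishes near the
  boundary point, so the kernel stays bounded where the weight lives and the integral has a limit
  \<open>b\<close> within the whole disk, hence within every Stolz region. The real part of the
  kernel vanishes for two points of the circle, so \<open>b\<close> is imaginary and only
  \<open>w \<zeta>\<^sub>0\<close> enters the modulus.\<close>

lemma nontangential_limit_exp_herglotz:
  assumes w: "integrable circle_measure w" and \<zeta>: "norm \<zeta>\<^sub>0 = 1"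
    and const: "\<forall>\<^sub>F \<zeta> in nhds \<zeta>\<^sub>0. w \<zeta> = w \<zeta>\<^sub>0"
  shows "\<exists>a. norm a = exp (w \<zeta>\<^sub>0) \<and> nontangential_limit (\<lambda>z. exp (herglotz w z)) \<zeta>\<^sub>0 a"
proof -
  interpret prob_space circle_measure by (rule prob_space_circle_measure)
  \<comment> \<open>The radius is doubled so that points outside the large ball keep distance at
    least \<open>r\<close> from points z in the ball of radius \<open>r\<close>.\<close>
  obtain r where r: "r > 0" and wr: "\<And>\<zeta>. dist \<zeta> \<zeta>\<^sub>0 < 2 * r \<Longrightarrow> w \<zeta> = w \<zeta>\<^sub>0"
  proof -
    obtain e where e: "e > 0" "\<And>\<zeta>. dist \<zeta> \<zeta>\<^sub>0 < e \<Longrightarrow> w \<zeta> = w \<zeta>\<^sub>0"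
      using const unfolding eventually_nhds_metric by blast
    show thesis
    proof (rule that[of "e / 2"])
      show "w \<zeta> = w \<zeta>\<^sub>0" if "dist \<zeta> \<zeta>\<^sub>0 < 2 * (e / 2)" for \<zeta>
        by (rule e(2)) (use that in simp)
    qed (use e(1) in simp)
  qed
  define u where "u \<zeta> = w \<zeta> - w \<zeta>\<^sub>0" for \<zeta>
  have u: "integrable circle_measure u" unfolding u_def using w by auto
  have [measurable]: "u \<in> borel_measurable borel" using borel_measurable_integrable[OF u] by simp
  have u0: "u \<zeta> = 0" if "dist \<zeta> \<zeta>\<^sub>0 < 2 * r" for \<zeta> using wr[OF that] by (simp add: u_def)
  define k where "k z \<zeta> = (\<zeta> + z) / (\<zeta> - z)" for z \<zeta> :: complex
  define b where "b = (LINT \<zeta>|circle_measure. k \<zeta>\<^sub>0 \<zeta> * complex_of_real (u \<zeta>))"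
  define S where "S = unit_disk \<inter> ball \<zeta>\<^sub>0 r"
  have bound: "norm (k z \<zeta> * complex_of_real (u \<zeta>)) \<le> 2 / r * \<bar>u \<zeta>\<bar>"
    if "norm \<zeta> = 1" "norm z \<le> 1" "dist z \<zeta>\<^sub>0 < r" for \<zeta> z
  proof (cases "dist \<zeta> \<zeta>\<^sub>0 < 2 * r")
    case False
    then have "r \<le> norm (\<zeta> - z)"
      using that dist_triangle[of \<zeta> \<zeta>\<^sub>0 z] by (simp add: dist_norm)
    moreover have "norm (\<zeta> + z) \<le> 2" using norm_triangle_ineq[of \<zeta> z] that by simp
    ultimately have "norm (k z \<zeta>) \<le> 2 / r"
      unfolding k_def norm_divide using r by (intro frac_le) auto
    then show ?thesis by (simp only: norm_mult norm_of_real mult_right_mono abs_ge_zero)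
  qed (simp add: u0)
  have lim: "((\<lambda>z. LINT \<zeta>|circle_measure. k z \<zeta> * complex_of_real (u \<zeta>)) \<longlongrightarrow> b) (at \<zeta>\<^sub>0 within S)"
    unfolding b_def
  proof (rule tendsto_LINT_kernel[OF u, where B = "2 / r"])
    show "k z \<in> borel_measurable circle_measure" "k \<zeta>\<^sub>0 \<in> borel_measurable circle_measure" for z
      unfolding k_def by measurable
    show "AE \<zeta> in circle_measure. ((\<lambda>z. k z \<zeta> * complex_of_real (u \<zeta>)) \<longlongrightarrow>
        k \<zeta>\<^sub>0 \<zeta> * complex_of_real (u \<zeta>)) (at \<zeta>\<^sub>0 within S)"
    proof (rule AE_I2)
      fix \<zeta>
      show "((\<lambda>z. k z \<zeta> * complex_of_real (u \<zeta>)) \<longlongrightarrow>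
        k \<zeta>\<^sub>0 \<zeta> * complex_of_real (u \<zeta>)) (at \<zeta>\<^sub>0 within S)"
      \<comment> \<open>At this single point the kernel has no limit to speak of, but
        \<open>u\<close> is 0 there.\<close>
      proof (cases "\<zeta> = \<zeta>\<^sub>0")
        case True
        then show ?thesis using r by (simp add: u0)
      next
        case False
        then show ?thesis unfolding k_def by (intro tendsto_intros) auto
      qed
    qed
    show "AE \<zeta> in circle_measure. norm (k z \<zeta> * complex_of_real (u \<zeta>)) \<le> 2 / r * \<bar>u \<zeta>\<bar>"
      if "z \<in> S" for z
      using AE_circle_measure_norm
      by eventually_elim (rule bound, use that in \<open>auto simp: S_def dist_commute\<close>)
  qed
  have herglotz_eq: "herglotz w z = (LINT \<zeta>|circle_measure. k z \<zeta> * complex_of_real (u \<zeta>)) + w \<zeta>\<^sub>0"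
    if "z \<in> unit_disk" for z
  proof -
    have "herglotz w z = (LINT \<zeta>|circle_measure.
       k z \<zeta> * complex_of_real (u \<zeta>) + k z \<zeta> * complex_of_real (w \<zeta>\<^sub>0))"
      unfolding herglotz_def u_def k_def
      by (simp only: of_real_diff right_diff_distrib diff_add_cancel)
    also have "\<dots> = (LINT \<zeta>|circle_measure. k z \<zeta> * complex_of_real (u \<zeta>)) + herglotz (\<lambda>_. w \<zeta>\<^sub>0) z"
      unfolding herglotz_def k_def
      by (intro Bochner_Integration.integral_add integrable_herglotz_kernel u that) auto
    finally show ?thesis using that by (simp only: herglotz_const)
  qed
  have "((\<lambda>z. herglotz w z) \<longlongrightarrow> b + w \<zeta>\<^sub>0) (at \<zeta>\<^sub>0 within S)"
    using tendsto_add[OF lim tendsto_const]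
    by (rule Lim_transform_eventually) (auto simp: eventually_at_filter S_def herglotz_eq)
  then have "((\<lambda>z. herglotz w z) \<longlongrightarrow> b + w \<zeta>\<^sub>0) (at \<zeta>\<^sub>0 within unit_disk)"
    using at_within_nhd[of \<zeta>\<^sub>0 "ball \<zeta>\<^sub>0 r" S unit_disk] r by (auto simp: S_def)
  then have "((\<lambda>z. exp (herglotz w z)) \<longlongrightarrow> exp (b + w \<zeta>\<^sub>0)) (at \<zeta>\<^sub>0 within unit_disk)"
    by (rule tendsto_exp)
  then have "nontangential_limit (\<lambda>z. exp (herglotz w z)) \<zeta>\<^sub>0 (exp (b + w \<zeta>\<^sub>0))"
    unfolding nontangential_limit_def stolz_region_def
    by (intro allI impI) (erule tendsto_within_subset, blast)
  moreover have "Re b = 0"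
  proof -
    have "Re b = (LINT \<zeta>|circle_measure. Re (k \<zeta>\<^sub>0 \<zeta> * complex_of_real (u \<zeta>)))"
      unfolding b_def
    proof (rule integral_Re[symmetric], rule Bochner_Integration.integrable_bound)
      show "integrable circle_measure (\<lambda>\<zeta>. 2 / r * \<bar>u \<zeta>\<bar>)" using u by auto
      show "(\<lambda>\<zeta>. k \<zeta>\<^sub>0 \<zeta> * complex_of_real (u \<zeta>)) \<in> borel_measurable circle_measure"
        unfolding k_def by measurable
      show "AE \<zeta> in circle_measure. norm (k \<zeta>\<^sub>0 \<zeta> * complex_of_real (u \<zeta>)) \<le> norm (2 / r * \<bar>u \<zeta>\<bar>)"
        using AE_circle_measure_norm
      proof eventually_elim
        case (elim \<zeta>)
        have "norm (k \<zeta>\<^sub>0 \<zeta> * complex_of_real (u \<zeta>)) \<le> 2 / r * \<bar>u \<zeta>\<bar>"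
          by (rule bound) (use elim \<zeta> r in auto)
        then show ?case using r by simp
      qed
    qed
    also have "\<dots> = (LINT \<zeta>|circle_measure. 0)"
    proof (rule integral_cong_AE)
      show "(\<lambda>\<zeta>. Re (k \<zeta>\<^sub>0 \<zeta> * complex_of_real (u \<zeta>))) \<in> borel_measurable circle_measure"
        unfolding k_def by measurable
      show "AE \<zeta> in circle_measure. Re (k \<zeta>\<^sub>0 \<zeta> * complex_of_real (u \<zeta>)) = 0"
        using AE_circle_measure_norm
      proof eventually_elim
        case (elim \<zeta>)
        have "Re (k \<zeta>\<^sub>0 \<zeta>) = 0" unfolding k_def Re_herglotz_kernel using elim \<zeta> by simp
        then show ?case by simp
      qed
    qed simp
    finally show ?thesis by simp
  qed
  ultimately show ?thesis by (intro exI[of _ "exp (b + w \<zeta>\<^sub>0)"]) simp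
qed

text \<open>The radial sequence \<open>X\<close> lies in the region: on a radius the distance to the
  endpoint is exactly 1 - |z|, and \<alpha> > 1. Nontriviality of the filter makes nontangential
  limits unique.\<close>

lemma trivial_limit_stolz:
  assumes "norm \<zeta> = 1" "\<alpha> > 1"
  shows "at \<zeta> within stolz_region \<alpha> \<zeta> \<noteq> bot"
proof -
  define d where "d n = 1 / (real n + 1)" for n
  define X where "X n = of_real (1 - d n) * \<zeta>" for n
  have d: "0 < d n" "d n \<le> 1" for n by (simp_all add: d_def)
  have nrm: "norm (X n) = 1 - d n" for n
    unfolding X_def norm_mult norm_of_real assms(1) using d[of n] by simp
  have dst: "dist (X n) \<zeta> = d n" for n
  proof -
    have "X n - \<zeta> = of_real (- d n) * \<zeta>" by (simp add: X_def algebra_simps)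
    then show ?thesis
      unfolding dist_norm using assms(1) d[of n] by (simp only: norm_mult norm_of_real)
  qed
  have "X n \<in> stolz_region \<alpha> \<zeta> - {\<zeta>}" for n
    using nrm[of n] dst[of n] d[of n] assms by (auto simp: stolz_region_def)
  moreover have "X \<longlonglongrightarrow> \<zeta>"
  proof -
    have "(\<lambda>n. 1 - d n) \<longlonglongrightarrow> 1" unfolding d_def by real_asymp
    then have "X \<longlonglongrightarrow> of_real 1 * \<zeta>" unfolding X_def by (intro tendsto_intros)
    then show ?thesis by simp
  qed
  ultimately have "\<zeta> islimpt stolz_region \<alpha> \<zeta>" unfolding islimpt_sequential by blast
  then show ?thesis by (simp add: trivial_limit_within)
qed

text \<open>Evaluates the \<open>THE\<close> in \<open>boundary_value\<close>. Uniqueness comes from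
  one Stolz region, here with aperture 2.\<close>

lemma boundary_value_eqI:
  assumes "norm \<zeta> = 1" "nontangential_limit f \<zeta> a"
  shows "boundary_value f \<zeta> = a"
  unfolding boundary_value_def
proof (rule the_equality)
  fix b assume "nontangential_limit f \<zeta> b"
  then show "b = a"
    using assms(2) trivial_limit_stolz[OF assms(1), of 2]
    unfolding nontangential_limit_def by (intro tendsto_unique[of "at \<zeta> within stolz_region 2 \<zeta>" f]) auto
qed (rule assms)

lemma nontangential_limit_mult:
  "nontangential_limit f \<zeta> a \<Longrightarrow> nontangential_limit g \<zeta> b \<Longrightarrow>
    nontangential_limit (\<lambda>z. f z * g z) \<zeta> (a * b)"
  unfolding nontangential_limit_def by (auto intro: tendsto_mult)

text \<open>The function is 1 / v, where v is the outer function with weight \<open>- w\<close>; v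
  is bounded by 1 because the Herglotz integral of a nonnegative weight has nonnegative real
  part.\<close>

lemma exp_herglotz_smirnov:
  assumes w: "integrable circle_measure w" "\<And>\<zeta>. 0 \<le> w \<zeta>"
  shows "(\<lambda>z. exp (herglotz w z)) \<in> smirnov_class"
proof -
  define v where "v z = exp (- herglotz w z)" for z
  have "v z = 1 * exp (herglotz (\<lambda>\<zeta>. - w \<zeta>) z)" for z
    by (simp add: v_def herglotz_def)
  then have "outer_function v"
    unfolding outer_function_def using w(1)
    by (intro exI[of _ 1] exI[of _ "\<lambda>\<zeta>. - w \<zeta>"]) auto
  moreover have "v holomorphic_on unit_disk"
    unfolding v_def by (intro holomorphic_intros holomorphic_herglotz w)
  moreover have "bounded (v ` unit_disk)"
    unfolding bounded_iff using Re_herglotz_nonneg[OF w] by (intro exI[of _ 1]) (auto simp: v_def)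
  moreover have "exp (herglotz w z) = 1 / v z" for z by (simp add: v_def exp_minus field_simps)
  ultimately show ?thesis
    unfolding smirnov_class_def
    by (intro CollectI exI[of _ "\<lambda>_. 1"] exI[of _ v]) (auto simp: image_constant_conv)
qed

section \<open>Step functions on dyadic arcs\<close>

lemma measurable_Arg [measurable]: "Arg \<in> borel_measurable borel"
proof -
  have *: "Arg = (\<lambda>z. if z = 0 then 0 else Im (Ln z))"
    by (auto simp: fun_eq_iff Arg_eq_Im_Ln Arg_zero)
  show ?thesis unfolding * by measurable
qed

text \<open>\<open>Suc n\<close> is the least exponent whose power lies below \<open>t\<close>; it
  is positive because \<open>t < 1\<close>.\<close>

lemma dyadic_between:
  fixes t :: real
  assumes "0 < t" "t < 1" "\<And>n. t \<noteq> (1/2) ^ n"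
  obtains n where "(1/2) ^ Suc n < t" "t < (1/2) ^ n"
proof -
  obtain k where k: "(1/2) ^ k < t" using real_arch_pow_inv[OF assms(1), of "1/2"] by auto
  define m where "m = (LEAST k. (1/2) ^ k < t)"
  have m: "(1/2) ^ m < t" unfolding m_def using k by (rule LeastI)
  then obtain n where n: "m = Suc n" using assms(2) by (cases m) auto
  have "\<not> (1/2) ^ n < t" using not_less_Least[of n "\<lambda>k. (1/2) ^ k < t"] n m_def by auto
  then show thesis using that[of n] m n assms(3)[of n] by simp
qed

text \<open>The length bound keeps the n-th piece between (1/2)^(n+1) and (1/2)^n. Hence the pieces
  are disjoint, lie in (0, 1) and accumulate only at 0.\<close>

locale dyadic_pieces =
  fixes len :: "nat \<Rightarrow> real"
  assumes length_pos: "0 < len n" and length_le: "len n \<le> (1/2) ^ Suc n"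
begin

definition piece :: "nat \<Rightarrow> real set" where
  "piece n = {(1/2) ^ Suc n <..< (1/2) ^ Suc n + len n}"

text \<open>At most one term is nonzero at each point, since the pieces are disjoint; the series
  form gives measurability directly.\<close>

definition step :: "(nat \<Rightarrow> real) \<Rightarrow> real \<Rightarrow> real" where
  "step c t = (\<Sum>n. c n * indicator (piece n) t)"

text \<open>Extended to the plane as a function constant on rays from 0, because the local constancy
  required for boundary values refers to neighbourhoods in the plane.\<close>

definition weight :: "(nat \<Rightarrow> real) \<Rightarrow> complex \<Rightarrow> real" where
  "weight c \<zeta> = step c (Arg \<zeta>)"

definition outer :: "(nat \<Rightarrow> real) \<Rightarrow> complex \<Rightarrow> complex" where
  "outer c z = exp (herglotz (weight c) z)"

lemma piece_upper: "t \<in> piece n \<Longrightarrow> t < (1/2) ^ n"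
  using length_le[of n] by (auto simp: piece_def)

lemma piece_lower: "t \<in> piece n \<Longrightarrow> (1/2) ^ Suc n < t"
  by (simp add: piece_def)

lemma piece_bounds: "t \<in> piece n \<Longrightarrow> 0 < t \<and> t < 1"
  using piece_upper[of t n] piece_lower[of t n] power_le_one[of "1/2::real" n]
    zero_less_power[of "1/2::real" "Suc n"] by linarith

lemma piece_unique:
  assumes "t \<in> piece m" "t \<in> piece n"
  shows "m = n"
proof -
  have False if "t \<in> piece m" "t \<in> piece n" "m < n" for m n
    using piece_lower[OF that(1)] piece_upper[OF that(2)]
      power_decreasing[of "Suc m" n "1/2::real"] that(3) by simp
  then show ?thesis using assms by (metis linorder_neqE_nat)
qed

lemma step_in:
  assumes "t \<in> piece n"
  shows "step c t = c n"
proof -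
  have "step c t = (\<Sum>m\<in>{n}. c m * indicator (piece m) t)"
    unfolding step_def
    by (rule suminf_finite) (use piece_unique[OF assms] in \<open>auto simp: indicator_def\<close>)
  then show ?thesis using assms by simp
qed

lemma step_out:
  assumes "\<And>n. t \<notin> piece n"
  shows "step c t = 0"
  unfolding step_def using assms by simp

lemma step_add: "step (\<lambda>n. c n + d n) t = step c t + step d t"
  by (cases "\<exists>n. t \<in> piece n") (auto simp: step_in step_out)

lemma step_nonneg: "(\<And>n. 0 \<le> c n) \<Longrightarrow> 0 \<le> step c t"
  by (cases "\<exists>n. t \<in> piece n") (auto simp: step_in step_out)

lemma piece_measurable [measurable]: "piece n \<in> sets borel"
  by (simp add: piece_def)

lemma emeasure_piece: "emeasure lborel (piece n) = ennreal (len n)"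
  using length_pos[of n] by (simp add: piece_def)

lemma step_measurable [measurable]: "step c \<in> borel_measurable borel"
  unfolding step_def by measurable

lemma weight_measurable [measurable]: "weight c \<in> borel_measurable borel"
  unfolding weight_def by measurable

text \<open>The excluded points are the endpoints of the pieces, the accumulation point 0 and the
  point 1. Any other point lies in an open piece or in an open set that meets no piece.\<close>

lemma step_locally_constant:
  assumes "t \<noteq> 0" "\<And>n. t \<noteq> (1/2) ^ n" "\<And>n. t \<noteq> (1/2) ^ Suc n + len n"
  shows "\<forall>\<^sub>F s in nhds t. step c s = step c t"
proof -
  have *: ?thesis if "open U" "t \<in> U" "\<And>s n. s \<in> U \<Longrightarrow> s \<notin> piece n" for U
    using that step_out unfolding eventually_nhds by (intro exI[of _ U]) metis
  \<comment> \<open>The power with exponent 0 excludes \<open>t = 1\<close>.\<close>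
  consider "t < 0" | "1 < t" | "0 < t" "t < 1" using assms(1) assms(2)[of 0] by fastforce
  then show ?thesis
  proof cases
    case 1
    show ?thesis by (rule *[of "{..<0}"]) (use 1 in \<open>auto dest!: piece_bounds\<close>)
  next
    case 2
    show ?thesis by (rule *[of "{1<..}"]) (use 2 in \<open>auto dest!: piece_bounds\<close>)
  next
    case 3
    then obtain n where n: "(1/2) ^ Suc n < t" "t < (1/2) ^ n"
      using dyadic_between assms(2) by blast
    show ?thesis
    proof (cases "t < (1/2) ^ Suc n + len n")
      case True
      then have "t \<in> piece n" using n by (simp add: piece_def)
      moreover have "open (piece n)" by (simp add: piece_def)
      ultimately show ?thesis
        unfolding eventually_nhds by (intro exI[of _ "piece n"]) (simp add: step_in)
    next
      case False
      show ?thesis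
      \<comment> \<open>This is the gap to the right of the n-th piece: pieces of smaller index lie
        above (1/2)^n, those of larger index below (1/2)^(n+1).\<close>
      proof (rule *[of "{(1/2) ^ Suc n + len n <..< (1/2) ^ n}"])
        show "t \<in> {(1/2) ^ Suc n + len n <..< (1/2) ^ n}" using n False assms(3)[of n] by simp
        fix s m assume s: "s \<in> {(1/2) ^ Suc n + len n <..< (1/2) ^ n}"
        show "s \<notin> piece m"
        proof
          assume sm: "s \<in> piece m"
          have "m \<noteq> n" using sm s by (auto simp: piece_def)
          moreover have "\<not> m < n"
            using piece_lower[OF sm] s power_decreasing[of "Suc m" n "1/2::real"] by auto
          moreover have "\<not> n < m"
            using piece_upper[OF sm] s power_decreasing[of "Suc n" m "1/2::real"] length_pos[of n]
            by auto
          ultimately show False by simp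
        qed
      qed simp
    qed
  qed
qed

text \<open>The exceptional set consists of the images of the excluded arguments and of -1, where
  \<open>Arg\<close> jumps. It depends on \<open>len\<close> alone, so the quantifier over
  \<open>c\<close> can stand inside.\<close>

lemma AE_weight_locally_constant:
  "AE \<zeta> in circle_measure. norm \<zeta> = 1 \<and> (\<forall>c. \<forall>\<^sub>F \<xi> in nhds \<zeta>. weight c \<xi> = weight c \<zeta>)"
proof -
  define E where "E = {0} \<union> range (\<lambda>n. (1/2) ^ n) \<union> range (\<lambda>n. (1/2) ^ Suc n + len n)"
  have "countable (insert (-1) (cis ` E))" by (simp add: E_def)
  from AE_circle_measure_not_in_countable[OF this] AE_circle_measure_norm
  show ?thesis
  proof eventually_elim
    case (elim \<zeta>)
    have \<zeta>: "\<zeta> = cis (Arg \<zeta>)" using elim(2) rcis_cmod_Arg[of \<zeta>] by (simp add: rcis_def)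
    then have "Arg \<zeta> \<notin> E" using elim(1) by auto
    then have lc: "\<forall>\<^sub>F s in nhds (Arg \<zeta>). step c s = step c (Arg \<zeta>)" for c
      by (intro step_locally_constant) (auto simp: E_def)
    have "\<zeta> \<notin> \<real>\<^sub>\<le>\<^sub>0"
    proof
      assume neg: "\<zeta> \<in> \<real>\<^sub>\<le>\<^sub>0"
      then obtain r where "\<zeta> = complex_of_real r" "r \<le> 0" by (auto elim: nonpos_Reals_cases)
      then show False using elim by simp
    qed
    then have "filterlim Arg (nhds (Arg \<zeta>)) (nhds \<zeta>)"
      using continuous_at_Arg by (simp add: isCont_def tendsto_at_iff_tendsto_nhds)
    from eventually_compose_filterlim[OF lc this] show ?case
      using elim(2) by (auto simp: weight_def)
  qed
qed

text \<open>The circle is parametrized by [0, 2 pi], whereas \<open>Arg\<close> has values in (-pi,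
  pi]. For t > pi the argument is t - 2 pi, and \<open>step c\<close> vanishes at both t and t - 2
  pi because the pieces lie in (0, 1).\<close>

lemma nn_integral_weight:
  assumes [measurable]: "\<phi> \<in> borel_measurable borel"
  shows "(\<integral>\<^sup>+ \<zeta>. ennreal (\<phi> (weight c \<zeta>)) \<partial>circle_measure) =
    (\<integral>\<^sup>+ t\<in>{0..2 * pi}. ennreal (\<phi> (step c t)) \<partial>lborel) / ennreal (2 * pi)"
proof -
  have "weight c (cis t) = step c t" if t: "t \<in> {0..2 * pi}" for t
  proof (cases "t \<le> pi")
    case True
    moreover have "- pi < t" using t pi_gt_zero unfolding atLeastAtMost_iff by linarith
    ultimately show ?thesis using Arg_cis[of t] by (simp add: weight_def)
  next
    case False
    then have "Arg (cis (t - 2 * pi)) = t - 2 * pi" using t by (intro Arg_cis) auto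
    then have "Arg (cis t) = t - 2 * pi" by (simp add: cis_divide[symmetric])
    moreover have "step c s = 0" if "s \<le> 0 \<or> 1 < s" for s
      using that by (intro step_out) (auto dest!: piece_bounds)
    ultimately show ?thesis using t False pi_gt3 by (simp add: weight_def)
  qed
  then have "(\<integral>\<^sup>+ t\<in>{0..2 * pi}. ennreal (\<phi> (weight c (cis t))) \<partial>lborel) =
      (\<integral>\<^sup>+ t\<in>{0..2 * pi}. ennreal (\<phi> (step c t)) \<partial>lborel)"
    by (intro nn_integral_cong) (auto simp: indicator_def)
  then show ?thesis by (subst nn_integral_circle_measure) auto
qed

text \<open>The integrand is at most \<phi>(0) on all of [0, 2 pi] plus the value of \<phi> on the
  piece containing the point, and both contributions integrate to something finite.\<close>

lemma nn_integral_weight_finite: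
  assumes [measurable]: "\<phi> \<in> borel_measurable borel"
    and nonneg: "0 \<le> \<phi> 0" "\<And>n. 0 \<le> \<phi> (c n)" and sum: "summable (\<lambda>n. len n * \<phi> (c n))"
  shows "(\<integral>\<^sup>+ \<zeta>. ennreal (\<phi> (weight c \<zeta>)) \<partial>circle_measure) < \<infinity>"
proof -
  have "(\<integral>\<^sup>+ t\<in>{0..2 * pi}. ennreal (\<phi> (step c t)) \<partial>lborel) \<le>
      (\<integral>\<^sup>+ t. ennreal (\<phi> 0) * indicator {0..2 * pi} t + (\<Sum>n. ennreal (\<phi> (c n)) * indicator (piece n) t) \<partial>lborel)"
  proof (intro nn_integral_mono)
    fix t
    show "ennreal (\<phi> (step c t)) * indicator {0..2 * pi} t \<le>
      ennreal (\<phi> 0) * indicator {0..2 * pi} t + (\<Sum>n. ennreal (\<phi> (c n)) * indicator (piece n) t)"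
    proof (cases "\<exists>n. t \<in> piece n")
      case True
      then obtain n where n: "t \<in> piece n" ..
      have "(\<Sum>m\<in>{n}. ennreal (\<phi> (c m)) * indicator (piece m) t) \<le>
          (\<Sum>n. ennreal (\<phi> (c n)) * indicator (piece n) t)"
        by (rule sum_le_suminf) auto
      then show ?thesis using n by (auto simp: step_in indicator_def intro: add_increasing)
    qed (auto simp: step_out)
  qed
  also have "\<dots> = ennreal (\<phi> 0) * ennreal (2 * pi) + (\<Sum>n. ennreal (\<phi> (c n)) * ennreal (len n))"
    by (simp add: nn_integral_add nn_integral_suminf nn_integral_cmult_indicator emeasure_piece)
  also have "(\<Sum>n. ennreal (\<phi> (c n)) * ennreal (len n)) = ennreal (\<Sum>n. len n * \<phi> (c n))"
    using nonneg length_pos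
    by (subst suminf_ennreal2[OF _ sum, symmetric]) (auto simp: less_imp_le ennreal_mult mult.commute)
  finally have "(\<integral>\<^sup>+ t\<in>{0..2 * pi}. ennreal (\<phi> (step c t)) \<partial>lborel) < \<infinity>"
    by (rule order_le_less_trans) (simp add: ennreal_mult_less_top)
  then show ?thesis by (simp add: nn_integral_weight ennreal_divide_eq_top_iff flip: less_top)
qed

text \<open>The integral over [0, 2 pi] dominates the contribution of each single piece, so
  unbounded contributions force it to be infinite.\<close>

lemma nn_integral_weight_infinite:
  assumes [measurable]: "\<phi> \<in> borel_measurable borel"
    and nonneg: "\<And>n. 0 \<le> \<phi> (c n)" and unbounded: "filterlim (\<lambda>n. len n * \<phi> (c n)) at_top sequentially"
  shows "(\<integral>\<^sup>+ \<zeta>. ennreal (\<phi> (weight c \<zeta>)) \<partial>circle_measure) = \<infinity>"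
proof -
  define I where "I = (\<integral>\<^sup>+ t\<in>{0..2 * pi}. ennreal (\<phi> (step c t)) \<partial>lborel)"
  have bound: "ennreal (len n * \<phi> (c n)) \<le> I" for n
  proof -
    have "ennreal (len n * \<phi> (c n)) = (\<integral>\<^sup>+ t. ennreal (\<phi> (c n)) * indicator (piece n) t \<partial>lborel)"
      using nonneg[of n] length_pos[of n]
      by (simp add: nn_integral_cmult_indicator emeasure_piece ennreal_mult mult.commute less_imp_le)
    also have "\<dots> \<le> I"
      unfolding I_def
    proof (rule nn_integral_mono)
      fix t
      show "ennreal (\<phi> (c n)) * indicator (piece n) t \<le> ennreal (\<phi> (step c t)) * indicator {0..2 * pi} t"
        using piece_bounds[of t n] pi_gt3 by (auto simp: indicator_def step_in)
    qed
    finally show ?thesis .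
  qed
  have "I = \<infinity>"
  proof (rule ccontr)
    assume "I \<noteq> \<infinity>"
    then obtain r where r: "I = ennreal r" "0 \<le> r" by (cases I) auto
    obtain n where "r + 1 \<le> len n * \<phi> (c n)"
      using unbounded unfolding filterlim_at_top eventually_sequentially by blast
    then show False using bound[of n] r by (simp add: ennreal_le_iff)
  qed
  then show ?thesis by (simp add: nn_integral_weight I_def ennreal_divide_eq_top_iff)
qed

lemma integrable_weight:
  assumes "\<And>n. 0 \<le> c n" "summable (\<lambda>n. len n * c n)"
  shows "integrable circle_measure (weight c)"
proof (rule integrableI_nonneg)
  show "(\<integral>\<^sup>+ \<zeta>. ennreal (weight c \<zeta>) \<partial>circle_measure) < \<infinity>"
    using nn_integral_weight_finite[of "\<lambda>x. x" c] assms by simp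
qed (auto simp: weight_def step_nonneg assms)

section \<open>Outer functions with step weights and the Hardy-Orlicz classes\<close>

lemma AE_outer:
  assumes "\<And>n. 0 \<le> c n" "summable (\<lambda>n. len n * c n)"
  shows "AE \<zeta> in circle_measure. norm \<zeta> = 1 \<and>
    (\<exists>a. norm a = exp (weight c \<zeta>) \<and> nontangential_limit (outer c) \<zeta> a)"
  using AE_weight_locally_constant
proof eventually_elim
  case (elim \<zeta>)
  then show ?case
    using nontangential_limit_exp_herglotz[OF integrable_weight[OF assms], of \<zeta>]
    by (simp add: outer_def[abs_def])
qed

text \<open>The boundary modulus is exp of the weight, which is never 0, so
  \<open>comp_log \<phi>\<close> of it is \<phi> of the weight almost everywhere. Monotonicity makes
  \<phi> Borel.\<close>

lemma outer_in_hardy_orlicz: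
  assumes c: "\<And>n. 0 \<le> c n" "summable (\<lambda>n. len n * c n)"
    and \<phi>: "strongly_convex \<phi>" "summable (\<lambda>n. len n * \<phi> (c n))"
  shows "outer c \<in> hardy_orlicz (comp_log \<phi>)"
proof -
  have "(\<lambda>z. exp (herglotz (weight c) z)) \<in> smirnov_class"
    by (intro exp_herglotz_smirnov integrable_weight c) (simp add: weight_def step_nonneg c)
  then have smirnov: "outer c \<in> smirnov_class" by (simp add: outer_def[abs_def])
  have "(\<integral>\<^sup>+ \<zeta>. ennreal (comp_log \<phi> (norm (boundary_value (outer c) \<zeta>))) \<partial>circle_measure) =
      (\<integral>\<^sup>+ \<zeta>. ennreal (\<phi> (weight c \<zeta>)) \<partial>circle_measure)"
  proof (rule nn_integral_cong_AE)
    show "AE \<zeta> in circle_measure. ennreal (comp_log \<phi> (norm (boundary_value (outer c) \<zeta>))) =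
        ennreal (\<phi> (weight c \<zeta>))"
      using AE_outer[OF c]
      by eventually_elim (auto simp: boundary_value_eqI comp_log_def)
  qed
  also have "\<dots> < \<infinity>"
    using \<phi> by (intro nn_integral_weight_finite) (auto simp: strongly_convex_def borel_measurable_mono)
  finally show ?thesis using smirnov by (simp add: hardy_orlicz_def)
qed

text \<open>Boundary values multiply and the weights add, so the product has boundary modulus exp of
  the weight for c + d; it is the integral condition that fails.\<close>

lemma outer_mult_not_in_hardy_orlicz:
  assumes c: "\<And>n. 0 \<le> c n" "summable (\<lambda>n. len n * c n)"
    and d: "\<And>n. 0 \<le> d n" "summable (\<lambda>n. len n * d n)"
    and \<phi>: "strongly_convex \<phi>" "filterlim (\<lambda>n. len n * \<phi> (c n + d n)) at_top sequentially"
  shows "(\<lambda>z. outer c z * outer d z) \<notin> hardy_orlicz (comp_log \<phi>)"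
proof -
  have "(\<integral>\<^sup>+ \<zeta>. ennreal (comp_log \<phi> (norm (boundary_value (\<lambda>z. outer c z * outer d z) \<zeta>))) \<partial>circle_measure) =
      (\<integral>\<^sup>+ \<zeta>. ennreal (\<phi> (weight (\<lambda>n. c n + d n) \<zeta>)) \<partial>circle_measure)"
  proof (rule nn_integral_cong_AE)
    show "AE \<zeta> in circle_measure.
        ennreal (comp_log \<phi> (norm (boundary_value (\<lambda>z. outer c z * outer d z) \<zeta>))) =
        ennreal (\<phi> (weight (\<lambda>n. c n + d n) \<zeta>))"
      using AE_outer[OF c] AE_outer[OF d]
    proof eventually_elim
      case (elim \<zeta>)
      then obtain a b where a: "norm a = exp (weight c \<zeta>)" "nontangential_limit (outer c) \<zeta> a"
        and b: "norm b = exp (weight d \<zeta>)" "nontangential_limit (outer d) \<zeta> b" by blast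
      have "boundary_value (\<lambda>z. outer c z * outer d z) \<zeta> = a * b"
        using elim a b by (intro boundary_value_eqI nontangential_limit_mult) auto
      moreover have "norm (a * b) = exp (weight (\<lambda>n. c n + d n) \<zeta>)"
        by (simp add: norm_mult a b weight_def step_add exp_add)
      ultimately show ?case by (auto simp: comp_log_def)
    qed
  qed
  also have "\<dots> = \<infinity>"
    using \<phi> by (intro nn_integral_weight_infinite) (auto simp: strongly_convex_def borel_measurable_mono)
  finally show ?thesis by (simp add: hardy_orlicz_def)
qed

end

section \<open>Choice of the parameters and the counterexample\<close>

lemma filterlim_iter_log: "filterlim (iter_log k) at_top at_top"
proof (induction k)
  case 0
  show ?case by (simp add: iter_log_def filterlim_ident)
next
  case (Suc k)
  show ?case
    using filterlim_compose[OF ln_at_top Suc] by (simp add: iter_log_def o_def)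
qed

theorem proposition5p1:
  fixes \<phi>_half :: "real \<Rightarrow> real" and \<phi> :: "nat \<Rightarrow> real \<Rightarrow> real"
  assumes "is_phi_half \<phi>_half"
    and "\<And>k. k \<ge> 2 \<Longrightarrow> is_phi_level k (\<phi> k)"
  shows "\<exists>g \<in> (\<Inter>k\<in>{2..}. hardy_orlicz (comp_log (\<phi> k))).
           g \<notin> Mult (hardy_orlicz (comp_log \<phi>_half))"
proof -
  have half: "strongly_convex \<phi>_half" "\<forall>\<^sub>F t in at_top. \<phi>_half t = exp (sqrt t)"
    using assms(1) by (auto simp: is_phi_half_def)
  \<comment> \<open>The factor 3 comes from completing the square: for n + 1 <= M, (M + n + 1)^2 =
    M^2 + 2 (n + 1) M + (n + 1)^2 is at most M^2 + 3 (n + 1) M.\<close>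
  define L where "L n = 3 * real (Suc n)" for n
  have L: "3 \<le> L n" for n by (simp add: L_def)
  \<comment> \<open>For fixed n these are finitely many conditions, each true for all large M. The
    iterated logarithms control \<phi> k for k <= n, the towers put \<open>L n * M\<close> where
    \<phi> k is prescribed, the bounds by 1 make both weights integrable, and the last two equations
    put the arguments where \<open>\<phi>_half\<close> is prescribed.\<close>
  have "\<exists>M. L n \<le> M \<and> (\<forall>j\<in>{..n}. L n \<le> iter_log j (L n * M)) \<and>
      (\<forall>j\<in>{..n}. exp_tower (2 * j) \<le> L n * M) \<and> L n * M * exp (- M) \<le> 1 \<and> M\<^sup>2 * exp (- M) \<le> 1 \<and>
      \<phi>_half (M\<^sup>2) = exp (sqrt (M\<^sup>2)) \<and> \<phi>_half (L n * M + M\<^sup>2) = exp (sqrt (L n * M + M\<^sup>2))" for n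
  proof -
    have pos: "L n > 0" using L[of n] by simp
    have LM: "filterlim (\<lambda>M. L n * M) at_top at_top"
      using pos by real_asymp
    have "\<forall>\<^sub>F M in at_top. L n \<le> iter_log j (L n * M)" for j
      using filterlim_compose[OF filterlim_iter_log LM] by (auto simp: filterlim_at_top)
    moreover have "\<forall>\<^sub>F M in at_top. exp_tower (2 * j) \<le> L n * M" for j
      using LM by (auto simp: filterlim_at_top)
    moreover have "((\<lambda>M. L n * M * exp (- M)) \<longlongrightarrow> 0) at_top" "((\<lambda>M::real. M\<^sup>2 * exp (- M)) \<longlongrightarrow> 0) at_top"
      using pos by real_asymp+
    then have "\<forall>\<^sub>F M in at_top. L n * M * exp (- M) < 1" "\<forall>\<^sub>F M in at_top. (M::real)\<^sup>2 * exp (- M) < 1"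
      by (auto intro: order_tendstoD)
    moreover have "\<forall>\<^sub>F M in at_top. \<phi>_half (M\<^sup>2) = exp (sqrt (M\<^sup>2))"
    proof -
      have "filterlim (\<lambda>M::real. M\<^sup>2) at_top at_top" by real_asymp
      from eventually_compose_filterlim[OF half(2) this] show ?thesis .
    qed
    moreover have "\<forall>\<^sub>F M in at_top. \<phi>_half (L n * M + M\<^sup>2) = exp (sqrt (L n * M + M\<^sup>2))"
    proof -
      have "filterlim (\<lambda>M::real. L n * M + M\<^sup>2) at_top at_top" using pos by real_asymp
      from eventually_compose_filterlim[OF half(2) this] show ?thesis .
    qed
    ultimately have "\<forall>\<^sub>F M in at_top. L n \<le> M \<and> (\<forall>j\<in>{..n}. L n \<le> iter_log j (L n * M)) \<and>
      (\<forall>j\<in>{..n}. exp_tower (2 * j) \<le> L n * M) \<and> L n * M * exp (- M) < 1 \<and> M\<^sup>2 * exp (- M) < 1 \<and>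
      \<phi>_half (M\<^sup>2) = exp (sqrt (M\<^sup>2)) \<and> \<phi>_half (L n * M + M\<^sup>2) = exp (sqrt (L n * M + M\<^sup>2))"
      by (intro eventually_conj eventually_ball_finite eventually_ge_at_top) auto
    from eventually_happens[OF this] show ?thesis by (auto intro: less_imp_le)
  qed
  then obtain M where M: "L n \<le> M n"
      and M_log: "\<And>j. j \<le> n \<Longrightarrow> L n \<le> iter_log j (L n * M n)"
      and M_tower: "\<And>j. j \<le> n \<Longrightarrow> exp_tower (2 * j) \<le> L n * M n"
      and M_exp: "L n * M n * exp (- M n) \<le> 1" "(M n)\<^sup>2 * exp (- M n) \<le> 1"
      and M_half: "\<phi>_half ((M n)\<^sup>2) = exp (sqrt ((M n)\<^sup>2))"
        "\<phi>_half (L n * M n + (M n)\<^sup>2) = exp (sqrt (L n * M n + (M n)\<^sup>2))" for n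
    by (metis atMost_iff)
  have Mpos: "0 < M n" for n using M[of n] L[of n] by linarith
  \<comment> \<open>The factor exp (- M n) compensates values of size up to exp (M n), and the power
    of 1/2 leaves a convergent geometric series.\<close>
  define len where "len n = (1/2) ^ Suc n * exp (- M n)" for n
  interpret dyadic_pieces len
    by unfold_locales (use Mpos in \<open>auto simp: len_def less_imp_le intro: mult_left_le\<close>)
  \<comment> \<open>The threshold \<open>m\<close> is there because \<phi> k is controlled only on
    the pieces with n >= k.\<close>
  have geometric: "summable (\<lambda>n. len n * x n)"
    if "\<And>n. m \<le> n \<Longrightarrow> 0 \<le> x n" "\<And>n. m \<le> n \<Longrightarrow> x n * exp (- M n) \<le> 1" for x m
  proof (rule summable_comparison_test')
    show "summable (\<lambda>n. (1/2) ^ Suc n :: real)" by (simp add: summable_geometric)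
    show "norm (len n * x n) \<le> (1/2) ^ Suc n" if "m \<le> n" for n
    proof -
      have "(1/2) ^ Suc n * (x n * exp (- M n)) \<le> (1/2) ^ Suc n * (1::real)"
        using that \<open>\<And>n. m \<le> n \<Longrightarrow> x n * exp (- M n) \<le> 1\<close> by (intro mult_left_mono) auto
      then show ?thesis
        using that \<open>\<And>n. m \<le> n \<Longrightarrow> 0 \<le> x n\<close> by (simp add: len_def abs_mult mult_ac)
    qed
  qed
  \<comment> \<open>These are the logarithms of the boundary moduli on the n-th arc:
    \<open>c\<close> for the multiplier g, \<open>d\<close> for the function f that it throws out of
    the class.\<close>
  define c where "c n = L n * M n" for n
  define d where "d n = (M n)\<^sup>2" for n
  have c: "0 \<le> c n" "summable (\<lambda>n. len n * c n)" for n
    using L Mpos M_exp by (auto intro!: geometric[of 0] simp: c_def less_imp_le order_trans[of 0 3])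
  have d: "0 \<le> d n" "summable (\<lambda>n. len n * d n)" for n
    using M_exp by (auto intro!: geometric[of 0] simp: d_def)
  have f: "outer d \<in> hardy_orlicz (comp_log \<phi>_half)"
  proof (rule outer_in_hardy_orlicz[OF d half(1)])
    \<comment> \<open>Since sqrt ((M n)^2) = M n, the value \<open>\<phi>_half (d n)\<close> is
      exactly exp (M n).\<close>
    show "summable (\<lambda>n. len n * \<phi>_half (d n))"
      using Mpos by (intro geometric[of 0]) (auto simp: d_def M_half exp_minus less_imp_le)
  qed
  have g: "outer c \<in> hardy_orlicz (comp_log (\<phi> k))" if k: "2 \<le> k" for k
  proof (rule outer_in_hardy_orlicz[OF c])
    show "strongly_convex (\<phi> k)" using assms(2)[OF k] by (simp add: is_phi_level_def)
    \<comment> \<open>The (k - 1)-fold logarithm of c n is at least L n, so the exponent in \<phi> k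
      (c n) is at most c n / L n = M n.\<close>
    have le: "0 \<le> \<phi> k (c n) \<and> \<phi> k (c n) * exp (- M n) \<le> 1" if "k \<le> n" for n
    proof -
      have eq: "\<phi> k (c n) = exp (c n / iter_log (k - 1) (c n))"
        using assms(2)[OF k] M_tower[OF that] by (simp add: is_phi_level_def c_def)
      have "L n \<le> iter_log (k - 1) (c n)" using M_log[of "k - 1" n] that by (simp add: c_def)
      then have "c n / iter_log (k - 1) (c n) \<le> c n / L n"
        using L[of n] c(1)[of n] by (intro divide_left_mono) (auto intro!: mult_pos_pos)
      also have "\<dots> = M n" using L[of n] by (simp add: c_def)
      finally have "\<phi> k (c n) \<le> exp (M n)" by (simp add: eq)
      then have "\<phi> k (c n) * exp (- M n) \<le> exp (M n) * exp (- M n)" by (rule mult_right_mono) simp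
      then show ?thesis by (simp add: eq exp_minus)
    qed
    then show "summable (\<lambda>n. len n * \<phi> k (c n))" by (intro geometric[of k]) auto
  qed
  have "(\<lambda>z. outer c z * outer d z) \<notin> hardy_orlicz (comp_log \<phi>_half)"
  proof (rule outer_mult_not_in_hardy_orlicz[OF c d half(1)])
    \<comment> \<open>The n-th piece contributes at least 2^-(n+1) exp (- M n) exp (M n + n + 1) =
      (e/2)^(n+1), which is unbounded because e > 2.\<close>
    have "1 < exp 1 / (2::real)" using exp_lower_Taylor_quadratic[of 1] by simp
    then have "filterlim (\<lambda>n. (exp 1 / 2) ^ Suc n :: real) at_top sequentially"
      unfolding filterlim_sequentially_Suc
      by (intro filterlim_at_infinity_imp_filterlim_at_top filterlim_realpow_sequentially_gt1) auto
    also have "(\<lambda>n. (exp 1 / 2) ^ Suc n) = (\<lambda>n. (1/2) ^ Suc n * exp (real (Suc n)))"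
      by (simp only: power_divide power_one exp_of_nat_mult[symmetric] mult_1_right) simp
    finally have "filterlim (\<lambda>n. (1/2) ^ Suc n * exp (real (Suc n))) at_top sequentially" .
    moreover have "(1/2) ^ Suc n * exp (real (Suc n)) \<le> len n * \<phi>_half (c n + d n)" for n
    proof -
      have "real (Suc n) \<le> M n" using M[of n] by (simp add: L_def)
      then have "real (Suc n) * real (Suc n) \<le> real (Suc n) * M n" by (intro mult_left_mono) auto
      then have "(M n + real (Suc n))\<^sup>2 \<le> c n + d n"
        by (simp add: c_def d_def L_def power2_eq_square algebra_simps)
      then have "M n + real (Suc n) \<le> sqrt (c n + d n)" by (rule real_le_rsqrt)
      then have "exp (M n + real (Suc n)) \<le> \<phi>_half (c n + d n)"
        using M_half(2)[of n] by (simp add: c_def d_def)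
      then have "(1/2) ^ Suc n * exp (- M n) * exp (M n + real (Suc n)) \<le> len n * \<phi>_half (c n + d n)"
        unfolding len_def by (rule mult_left_mono) simp
      moreover have "exp (- M n) * exp (M n + real (Suc n)) = exp (real (Suc n))"
        by (simp flip: exp_add)
      ultimately show ?thesis by (simp only: mult.assoc)
    qed
    ultimately show "filterlim (\<lambda>n. len n * \<phi>_half (c n + d n)) at_top sequentially"
      by (rule filterlim_at_top_mono[OF _ always_eventually[OF allI]])
  qed
  then have "outer c \<notin> Mult (hardy_orlicz (comp_log \<phi>_half))"
    using f by (auto simp: Mult_def)
  then show ?thesis using g by (intro bexI[of _ "outer c"]) auto
qed

end
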